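(* Let $S$ be a commutative semiring with a nonzero identity and $M$ a content $S$-semimodule. Suppose that the content function $c$ from $M$ to the set of finitely generated ideals of $S$ is onto. If the graph $\Gamma_{(\operatorname{Id}(S),c)}(M)$ is non-empty, where $\operatorname{Id}(S)$ is the commutative semigroup of ideals of $S$ under multiplication of ideals, then it is a connected graph with diameter at most $3$.
   Context: A commutative semiring with identity $(S,+,\cdot,0,1)$ consists of commutative monoids $(S,+,0)$ and $(S,\cdot,1)$ with multiplication distributing over addition and $0\cdot s=0$ for all $s$. A unital $S$-semimodule $M$ is a commutative additive monoid with a bi-additive action of $S$ satisfying $(st)m=s(tm)$, $1m=m$, $0_S m=0_M$ and $s0_M=0_M$. An ideal of $S$ is a non-empty subset closed under addition and under multiplication by elements of $S$; $\operatorname{Id}(S)$ is the set of all ideals of $S$. The product $IJ$ of ideals is the set of finite sums of products $ab$ with $a\in I$, $b\in J$; the zero of the semigroup $\operatorname{Id}(S)$ under this product is $(0)$. For an ideal $I$, $IM$ is the set of finite sums of elements $am$ with $a\in I$, $m\in M$. For a unital $S$-semimodule $M$, the content function $c:M\to\operatorname{Id}(S)$ is $c(x)=\bigcap\{I\in\operatorname{Id}(S): x\in IM\}$. $M$ is a content $S$-semimodule if $x\in c(x)M$ for all $x\in M$; in that case it is known that $c(x)$ is a finitely generated ideal of $S$ for each $x\in M$. For a non-empty set $X$, a commutative semigroup with zero $(T,\cdot,0)$ and a function $f:X\to T$, the simple graph $\Gamma_{(T,f)}(X)$ is defined as follows. An element $x\in X$ is a vertex if $f(x)\neq 0$ and there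 is a $y\in X$ with $y\neq x$, $f(y)\neq 0$ and $f(x)\cdot f(y)=0$. For $x,y\in X$, $\{x,y\}$ is an edge if $x\neq y$, $f(x)\neq 0$, $f(y)\neq 0$ and $f(x)\cdot f(y)=0$. The graph is non-empty if it has at least one vertex; its diameter is the greatest distance between any two vertices, distance being the number of edges in a shortest path. *)

theory Defs
  imports Main "HOL.Hull" "Graph_Theory.Graph_Theory"
begin

section \<open>Ideals of a commutative semiring\<close>

definition is_ideal :: "'a::comm_semiring_1 set \<Rightarrow> bool" where
  "is_ideal I \<longleftrightarrow> I \<noteq> {} \<and> (\<forall>a\<in>I. \<forall>b\<in>I. a + b \<in> I) \<and> (\<forall>s. \<forall>a\<in>I. s * a \<in> I)"

lemma is_ideal_0: "0 \<in> I" if "is_ideal I"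
proof -
  from that obtain a where "a \<in> I" by (auto simp: is_ideal_def)
  with that have "0 * a \<in> I" unfolding is_ideal_def by blast
  then show ?thesis by simp
qed

lemma is_ideal_add: "is_ideal I \<Longrightarrow> a \<in> I \<Longrightarrow> b \<in> I \<Longrightarrow> a + b \<in> I"
  by (auto simp: is_ideal_def)

lemma is_ideal_mult: "is_ideal I \<Longrightarrow> a \<in> I \<Longrightarrow> s * a \<in> I"
  by (auto simp: is_ideal_def)

typedef (overloaded) ('a::comm_semiring_1) ideal = "{I :: 'a set. is_ideal I}"
  morphisms ideal_set Abs_ideal
  by (rule exI[of _ UNIV]) (simp add: is_ideal_def)

setup_lifting type_definition_ideal

text \<open>Lists represent finite sums; the empty sum contributes only \<open>0\<close>, which is in the product anyway.\<close>

definition set_times :: "'a::comm_semiring_1 set \<Rightarrow> 'a set \<Rightarrow> 'a set" where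
  "set_times I J = {\<Sum>(a, b)\<leftarrow>ps. a * b | ps. set ps \<subseteq> I \<times> J}"

lemma set_times_prod: "a \<in> I \<Longrightarrow> b \<in> J \<Longrightarrow> a * b \<in> set_times I J"
  unfolding set_times_def by (rule CollectI, rule exI[of _ "[(a, b)]"]) simp

lemma set_times_least:
  assumes "is_ideal K" and "\<And>a b. a \<in> I \<Longrightarrow> b \<in> J \<Longrightarrow> a * b \<in> K"
  shows "set_times I J \<subseteq> K"
proof
  fix x assume "x \<in> set_times I J"
  then obtain ps where x: "x = (\<Sum>(a, b)\<leftarrow>ps. a * b)" and ps: "set ps \<subseteq> I \<times> J"
    by (auto simp: set_times_def)
  from ps have "(\<Sum>(a, b)\<leftarrow>ps. a * b) \<in> K"
    by (induction ps) (auto intro!: is_ideal_add[OF assms(1)] is_ideal_0[OF assms(1)] assms(2))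
  with x show "x \<in> K" by simp
qed

lemma is_ideal_set_times:
  assumes "is_ideal I"
  shows "is_ideal (set_times I J)"
  unfolding is_ideal_def
proof (intro conjI ballI allI)
  show "set_times I J \<noteq> {}"
    unfolding set_times_def by (auto intro: exI[of _ "[]"])
next
  fix x y assume "x \<in> set_times I J" "y \<in> set_times I J"
  then obtain ps qs where "x = (\<Sum>(a, b)\<leftarrow>ps. a * b)" "set ps \<subseteq> I \<times> J"
    "y = (\<Sum>(a, b)\<leftarrow>qs. a * b)" "set qs \<subseteq> I \<times> J"
    by (auto simp: set_times_def)
  then show "x + y \<in> set_times I J"
    unfolding set_times_def by (intro CollectI exI[of _ "ps @ qs"]) simp
next
  fix s x assume "x \<in> set_times I J"
  then obtain ps where x: "x = (\<Sum>(a, b)\<leftarrow>ps. a * b)" and ps: "set ps \<subseteq> I \<times> J"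
    by (auto simp: set_times_def)
  have "s * x = (\<Sum>(a, b)\<leftarrow>map (\<lambda>(a, b). (s * a, b)) ps. a * b)"
    unfolding x by (induction ps) (auto simp: algebra_simps)
  moreover have "set (map (\<lambda>(a, b). (s * a, b)) ps) \<subseteq> I \<times> J"
    using ps is_ideal_mult[OF assms] by auto
  ultimately show "s * x \<in> set_times I J"
    unfolding set_times_def by blast
qed

lemma set_times_commute: "set_times I J = set_times J I"
proof -
  have "set_times A B \<subseteq> set_times B A" for A B :: "'a set"
  proof
    fix x assume "x \<in> set_times A B"
    then obtain ps where x: "x = (\<Sum>(a, b)\<leftarrow>ps. a * b)" and ps: "set ps \<subseteq> A \<times> B"
      by (auto simp: set_times_def)
    have "x = (\<Sum>(a, b)\<leftarrow>map (\<lambda>(a, b). (b, a)) ps. a * b)"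
      unfolding x by (induction ps) (auto simp: algebra_simps)
    moreover have "set (map (\<lambda>(a, b). (b, a)) ps) \<subseteq> B \<times> A"
      using ps by auto
    ultimately show "x \<in> set_times B A"
      unfolding set_times_def by blast
  qed
  then show ?thesis by blast
qed

lemma set_times_assoc_le:
  assumes "is_ideal I" "is_ideal J"
  shows "set_times (set_times I J) K \<subseteq> set_times I (set_times J K)"
proof (rule set_times_least[OF is_ideal_set_times[OF assms(1)]])
  fix x c assume "x \<in> set_times I J" and c: "c \<in> K"
  then obtain ps where x: "x = (\<Sum>(a, b)\<leftarrow>ps. a * b)" and ps: "set ps \<subseteq> I \<times> J"
    by (auto simp: set_times_def)
  have "x * c = (\<Sum>(a, b)\<leftarrow>map (\<lambda>(a, b). (a, b * c)) ps. a * b)"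
    unfolding x by (induction ps) (auto simp: algebra_simps)
  moreover have "set (map (\<lambda>(a, b). (a, b * c)) ps) \<subseteq> I \<times> set_times J K"
    using ps set_times_prod[OF _ c] by auto
  ultimately show "x * c \<in> set_times I (set_times J K)"
    unfolding set_times_def[of I] by blast
qed

lemma set_times_assoc:
  assumes "is_ideal I" "is_ideal J" "is_ideal K"
  shows "set_times (set_times I J) K = set_times I (set_times J K)"
proof
  show "set_times (set_times I J) K \<subseteq> set_times I (set_times J K)"
    by (rule set_times_assoc_le[OF assms(1,2)])
  have "set_times I (set_times J K) = set_times (set_times K J) I"
    by (metis set_times_commute)
  also have "\<dots> \<subseteq> set_times K (set_times J I)"
    by (rule set_times_assoc_le[OF assms(3,2)])
  also have "\<dots> = set_times (set_times I J) K"
    by (metis set_times_commute)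
  finally show "set_times I (set_times J K) \<subseteq> set_times (set_times I J) K" .
qed

lemma set_times_zero: "set_times {0} J = {0}" if "is_ideal J" for J :: "'a::comm_semiring_1 set"
proof
  show "set_times {0} J \<subseteq> {0}"
    by (rule set_times_least) (auto simp: is_ideal_def)
  show "{0} \<subseteq> set_times {0} J"
    using is_ideal_0[OF is_ideal_set_times, of "{0}" J] by (simp add: is_ideal_def)
qed

instantiation ideal :: (comm_semiring_1) "{ab_semigroup_mult, mult_zero}"
begin

lift_definition zero_ideal :: "'a ideal" is "{0}"
  by (simp add: is_ideal_def)

lift_definition times_ideal :: "'a ideal \<Rightarrow> 'a ideal \<Rightarrow> 'a ideal" is set_times
  by (rule is_ideal_set_times)

instance
proof
  fix I J K :: "'a ideal"
  show "I * J * K = I * (J * K)" by transfer (rule set_times_assoc)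
  show "I * J = J * I" by transfer (rule set_times_commute)
  show "0 * I = 0" by transfer (rule set_times_zero)
  show "I * 0 = 0" by transfer (subst set_times_commute, rule set_times_zero)
qed

end

instantiation ideal :: (comm_semiring_1) Inf
begin

lift_definition Inf_ideal :: "'a ideal set \<Rightarrow> 'a ideal" is "\<lambda>\<I>. \<Inter>\<I>"
proof -
  fix \<I> :: "'a set set"
  assume I: "\<And>I. I \<in> \<I> \<Longrightarrow> is_ideal I"
  then have "0 \<in> \<Inter>\<I>" by (auto intro: is_ideal_0)
  then show "is_ideal (\<Inter>\<I>)"
    unfolding is_ideal_def using I by (auto intro: is_ideal_add is_ideal_mult)
qed

instance ..

end

definition finitely_generated :: "'a::comm_semiring_1 ideal \<Rightarrow> bool" where
  "finitely_generated I \<longleftrightarrow> (\<exists>G. finite G \<and> ideal_set I = is_ideal hull G)"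


section \<open>Semimodules and the content function\<close>

locale semimodule =
  fixes scale :: "'a::comm_semiring_1 \<Rightarrow> 'b::comm_monoid_add \<Rightarrow> 'b" (infixr \<open>*s\<close> 75)
  assumes scale_right_distrib: "s *s (x + y) = s *s x + s *s y"
    and scale_left_distrib: "(s + t) *s x = s *s x + t *s x"
    and scale_scale: "(s * t) *s x = s *s (t *s x)"
    and scale_one: "1 *s x = x"
    and scale_zero_left: "0 *s x = 0"
    and scale_zero_right: "s *s 0 = 0"
begin

text \<open>The subset \<open>IM\<close> of the semimodule \<open>M\<close>.\<close>

definition ideal_scale :: "'a ideal \<Rightarrow> 'b set" where
  "ideal_scale I = {\<Sum>(a, m)\<leftarrow>ps. a *s m | ps. set ps \<subseteq> ideal_set I \<times> UNIV}"

definition content :: "'b \<Rightarrow> 'a ideal" where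
  "content x = Inf {I. x \<in> ideal_scale I}"

end

locale content_semimodule = semimodule +
  assumes content_mem: "x \<in> ideal_scale (content x)"


section \<open>The zero-divisor graph of a function into a semigroup with zero\<close>

text \<open>
  An edge \<open>{x, y}\<close> is represented by the two opposite arcs \<open>(x, y)\<close> and \<open>(y, x)\<close>.
\<close>

definition zero_divisor_graph ::
  "('x \<Rightarrow> 't::{ab_semigroup_mult, mult_zero}) \<Rightarrow> 'x set \<Rightarrow> 'x pair_pre_digraph" where
  "zero_divisor_graph f X =
    \<lparr> pverts = {x \<in> X. f x \<noteq> 0 \<and> (\<exists>y\<in>X. y \<noteq> x \<and> f y \<noteq> 0 \<and> f x * f y = 0)},
      parcs = {(x, y). x \<in> X \<and> y \<in> X \<and> x \<noteq> y \<and> f x \<noteq> 0 \<and> f y \<noteq> 0 \<and> f x * f y = 0} \<rparr>"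

lemma pair_bidirected_digraph_zero_divisor_graph:
  "pair_bidirected_digraph (zero_divisor_graph f X)"
proof
  fix e assume "e \<in> parcs (zero_divisor_graph f X)"
  then obtain x y where e: "e = (x, y)" "x \<in> X" "y \<in> X" "x \<noteq> y" "f x \<noteq> 0" "f y \<noteq> 0"
      "f x * f y = 0" "f y * f x = 0"
    by (auto simp: zero_divisor_graph_def mult.commute)
  then show "fst e \<in> pverts (zero_divisor_graph f X)" "snd e \<in> pverts (zero_divisor_graph f X)"
      "fst e \<noteq> snd e"
    unfolding zero_divisor_graph_def by force+
next
  show "symmetric (with_proj (zero_divisor_graph f X))"
    by (auto simp: zero_divisor_graph_def mult.commute arcs_ends_def arc_to_ends_def
        with_proj_def symmetric_def sym_def)
qed

text \<open>
  With unit weights \<open>wf_digraph.\<mu>\<close> is the number of edges in a shortest walk, hence in a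
  shortest path; it is \<open>\<infinity>\<close> between vertices in different components.
\<close>

definition graph_distance :: "'x pair_pre_digraph \<Rightarrow> 'x \<Rightarrow> 'x \<Rightarrow> ereal" where
  "graph_distance G u v = wf_digraph.\<mu> (with_proj G) (\<lambda>_. 1) u v"

text \<open>
  Being a supremum in the extended reals, the diameter is \<open>\<infinity>\<close> for a disconnected graph
  and is meaningful only for a graph with at least one vertex.
\<close>

definition graph_diameter :: "'x pair_pre_digraph \<Rightarrow> ereal" where
  "graph_diameter G = (SUP u\<in>pverts G. SUP v\<in>pverts G. graph_distance G u v)"

end

theory Submission
  imports Defs
begin

text \<open>
  The bound is the classical one for zero-divisor graphs, and the argument takes place in the
  semigroup of ideals.  Let \<open>x\<close> and \<open>y\<close> be distinct vertices with neighbours \<open>a\<close> and \<open>b\<close>, and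
  suppose that they are not adjacent, so \<open>c(x)c(y) \<noteq> 0\<close>.  If \<open>c(a)c(b) = 0\<close>, then \<open>x, a, b, y\<close> is a
  walk of length three, except that it collapses to \<open>x, a, y\<close> when \<open>a = b\<close>.  If \<open>c(a)c(b) \<noteq> 0\<close>, then
  the product is annihilated by both \<open>c(x)\<close> and \<open>c(y)\<close>, and any \<open>z\<close> whose content is a nonzero ideal
  inside \<open>c(a)c(b)\<close> is a common neighbour of \<open>x\<close> and \<open>y\<close>.

  Surjectivity of \<open>c\<close> serves to find such a \<open>z\<close>: a nonzero element \<open>u\<close> of \<open>c(a)c(b)\<close> generates a
  principal, hence finitely generated, ideal, which is the content of some \<open>z\<close>.  Since this ideal
  is contained in \<open>c(a)c(b)\<close>, whatever annihilates \<open>c(a)c(b)\<close> annihilates it too.  The graph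
  argument is carried out for any function \<open>f\<close> into a commutative semigroup with zero such that
  every nonzero product \<open>f a * f b\<close> can be replaced in this way by a nonzero value of \<open>f\<close>
  (\<open>zero_divisor_graph_short_walk\<close>).
\<close>

section \<open>Zero-divisor graphs of functions\<close>

lemma wf_digraph_zero_divisor_graph: "wf_digraph (with_proj (zero_divisor_graph f X))"
proof -
  interpret pair_bidirected_digraph "zero_divisor_graph f X"
    by (rule pair_bidirected_digraph_zero_divisor_graph)
  show ?thesis by (rule wf_digraph)
qed

lemma vertex_iff_ex_edge:
  "x \<in> pverts (zero_divisor_graph f X) \<longleftrightarrow> (\<exists>y. (x, y) \<in> parcs (zero_divisor_graph f X))"
  by (auto simp: zero_divisor_graph_def)

lemma edge_iff:
  "(x, y) \<in> parcs (zero_divisor_graph f X) \<longleftrightarrow>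
    x \<in> X \<and> y \<in> X \<and> x \<noteq> y \<and> f x \<noteq> 0 \<and> f y \<noteq> 0 \<and> f x * f y = 0"
  by (simp add: zero_divisor_graph_def)

lemma edge_sym:
  "(x, y) \<in> parcs (zero_divisor_graph f X) \<Longrightarrow> (y, x) \<in> parcs (zero_divisor_graph f X)"
  by (auto simp: edge_iff mult.commute)

text \<open>
  The hypothesis \<open>dom\<close> is a weak form of closure of the image of \<open>f\<close> under nonzero products.  It
  produces the middle vertex of a walk of length two when the neighbours \<open>a\<close> of \<open>x\<close> and \<open>b\<close> of \<open>y\<close>
  satisfy \<open>f a * f b \<noteq> 0\<close>: this product is annihilated by \<open>f x\<close> through its factor \<open>f a\<close> and by
  \<open>f y\<close> through its factor \<open>f b\<close>.
\<close>

lemma zero_divisor_graph_short_walk: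
  fixes f :: "'x \<Rightarrow> 't::{ab_semigroup_mult, mult_zero}"
  assumes dom: "\<And>a b. a \<in> X \<Longrightarrow> b \<in> X \<Longrightarrow> f a * f b \<noteq> 0 \<Longrightarrow>
      \<exists>z\<in>X. f z \<noteq> 0 \<and> (\<forall>t. f a * f b * t = 0 \<longrightarrow> f z * t = 0)"
    and x: "x \<in> pverts (zero_divisor_graph f X)"
    and y: "y \<in> pverts (zero_divisor_graph f X)"
  shows "\<exists>p. pre_digraph.awalk (with_proj (zero_divisor_graph f X)) x p y \<and> length p \<le> 3"
proof -
  let ?G = "zero_divisor_graph f X"
  interpret wf_digraph "with_proj ?G" by (rule wf_digraph_zero_divisor_graph)
  obtain a where xa: "(x, a) \<in> parcs ?G" using x vertex_iff_ex_edge by metis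
  obtain b where yb: "(y, b) \<in> parcs ?G" using y vertex_iff_ex_edge by metis
  consider "x = y" | "x \<noteq> y" "f x * f y = 0"
    | "f x * f y \<noteq> 0" "f a * f b = 0" | "f x * f y \<noteq> 0" "f a * f b \<noteq> 0"
    by blast
  then show ?thesis
  proof cases
    case 1
    then have "awalk x [] y" using x by (simp add: awalk_Nil_iff)
    then show ?thesis by (intro exI[of _ "[]"]) simp
  next
    case 2
    then have "(x, y) \<in> parcs ?G" using xa yb by (simp add: edge_iff)
    then have "awalk x [(x, y)] y" using y by (simp add: awalk_simps)
    then show ?thesis by (intro exI[of _ "[(x, y)]"]) simp
  next
    case 3
    show ?thesis
    proof (cases "a = b")
      case True
      have "awalk x [(x, a), (a, y)] y"
        using xa edge_sym[OF yb] y True by (simp add: awalk_simps)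
      then show ?thesis by (intro exI[of _ "[(x, a), (a, y)]"]) simp
    next
      case False
      then have "(a, b) \<in> parcs ?G" using 3 xa yb by (simp add: edge_iff)
      then have "awalk x [(x, a), (a, b), (b, y)] y"
        using xa edge_sym[OF yb] y by (simp add: awalk_simps)
      then show ?thesis by (intro exI[of _ "[(x, a), (a, b), (b, y)]"]) simp
    qed
  next
    case 4
    obtain z where z: "z \<in> X" "f z \<noteq> 0"
      and ann: "\<And>t. f a * f b * t = 0 \<Longrightarrow> f z * t = 0"
      using dom[OF _ _ 4(2)] xa yb by (auto simp: edge_iff)
    have "f a * f b * f x = f b * (f x * f a)" "f a * f b * f y = f a * (f y * f b)"
      by (simp_all add: ac_simps)
    then have zx: "f z * f x = 0" and zy: "f z * f y = 0"
      using xa yb by (simp_all add: edge_iff ann)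
    \<comment> \<open>If \<open>z\<close> were one of \<open>x\<close>, \<open>y\<close>, then \<open>zx\<close> and \<open>zy\<close> would make \<open>x\<close> and \<open>y\<close> adjacent.\<close>
    have "z \<noteq> x" "z \<noteq> y" using zx zy 4(1) by (auto simp: mult.commute)
    then have "(x, z) \<in> parcs ?G" "(z, y) \<in> parcs ?G"
      using z zx zy xa yb by (auto simp: edge_iff mult.commute)
    then have "awalk x [(x, z), (z, y)] y" using y by (simp add: awalk_simps)
    then show ?thesis by (intro exI[of _ "[(x, z), (z, y)]"]) simp
  qed
qed

lemma connected_graph_diameter_le_if_short_walks:
  assumes wf: "wf_digraph (with_proj G)"
    and ne: "pverts G \<noteq> {}"
    and walk: "\<And>x y. x \<in> pverts G \<Longrightarrow> y \<in> pverts G \<Longrightarrow>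
      \<exists>p. pre_digraph.awalk (with_proj G) x p y \<and> length p \<le> n"
  shows "Digraph_Component.connected (with_proj G) \<and> graph_diameter G \<le> real n"
proof
  interpret wf_digraph "with_proj G" by (rule wf)
  have "x \<rightarrow>\<^sup>*\<^bsub>mk_symmetric (with_proj G)\<^esub> y" if "x \<in> pverts G" "y \<in> pverts G" for x y
    using walk[OF that] reachable_awalk reachable_mk_symmetricI by blast
  then show "Digraph_Component.connected (with_proj G)"
    unfolding Digraph_Component.connected_def strongly_connected_def using ne by simp
  have "graph_distance G x y \<le> real n" if xy: "x \<in> pverts G" "y \<in> pverts G" for x y
  proof -
    obtain p where p: "awalk x p y" "length p \<le> n" using walk[OF xy] by blast
    have "graph_distance G x y \<le> awalk_cost (\<lambda>_. 1) p"
      unfolding graph_distance_def by (rule min_cost_le_walk_cost[OF p(1)])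
    also have "awalk_cost (\<lambda>_. 1) p = real (length p)"
      by (simp add: awalk_cost_def sum_list_triv)
    also have "ereal (real (length p)) \<le> real n" using p(2) by simp
    finally show ?thesis .
  qed
  then show "graph_diameter G \<le> real n"
    unfolding graph_diameter_def by (intro SUP_least)
qed


section \<open>Annihilators of ideals\<close>

lemma ideal_eq_0_iff: "I = 0 \<longleftrightarrow> ideal_set I \<subseteq> {0}"
proof -
  have "0 \<in> ideal_set I" using ideal_set is_ideal_0 by blast
  then show ?thesis by (auto simp: ideal_set_inject[symmetric] zero_ideal.rep_eq)
qed

lemma times_ideal_mono_zero:
  assumes "ideal_set J \<subseteq> ideal_set I" "I * K = 0"
  shows "J * K = 0"
proof -
  have "ideal_set (J * K) \<subseteq> ideal_set (I * K)"
    using assms(1) unfolding times_ideal.rep_eq set_times_def by blast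
  with assms(2) show ?thesis by (simp add: ideal_eq_0_iff)
qed

lemma nonzero_ideal_has_nonzero_finitely_generated_subideal:
  assumes "I \<noteq> 0"
  shows "\<exists>J. finitely_generated J \<and> J \<noteq> 0 \<and> ideal_set J \<subseteq> ideal_set I"
proof -
  obtain u where u: "u \<in> ideal_set I" "u \<noteq> 0" using assms by (auto simp: ideal_eq_0_iff)
  let ?U = "is_ideal hull {u}"
  have "is_ideal ?U"
  proof (rule hull_in)
    fix T :: "'a set set" assume T: "Ball T is_ideal"
    then have "0 \<in> \<Inter>T" using is_ideal_0 by blast
    then show "is_ideal (\<Inter>T)"
      using T unfolding is_ideal_def[of "\<Inter>T"] by (auto intro: is_ideal_add is_ideal_mult)
  qed
  then have U: "ideal_set (Abs_ideal ?U) = ?U" by (simp add: Abs_ideal_inverse)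
  have "u \<in> ?U" by (simp add: hull_inc)
  then have "Abs_ideal ?U \<noteq> 0" using u(2) by (auto simp: ideal_eq_0_iff U)
  moreover have "finitely_generated (Abs_ideal ?U)"
    unfolding finitely_generated_def U by blast
  moreover have "?U \<subseteq> ideal_set I" by (rule hull_minimal) (use u(1) ideal_set in auto)
  ultimately show ?thesis using U by metis
qed


section \<open>The graph of the content function\<close>

theorem corollary3p9:
  fixes scale :: "'a::comm_semiring_1 \<Rightarrow> 'b::comm_monoid_add \<Rightarrow> 'b"
  assumes "content_semimodule scale"
    and "\<forall>I. finitely_generated I \<longrightarrow> (\<exists>x. semimodule.content scale x = I)"
    and "pverts (zero_divisor_graph (semimodule.content scale) UNIV) \<noteq> {}"
  shows "Digraph_Component.connected (with_proj (zero_divisor_graph (semimodule.content scale) UNIV))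
    \<and> graph_diameter (zero_divisor_graph (semimodule.content scale) UNIV) \<le> 3"
proof -
  let ?c = "semimodule.content scale"
  have "\<exists>z\<in>UNIV. ?c z \<noteq> 0 \<and> (\<forall>K. ?c a * ?c b * K = 0 \<longrightarrow> ?c z * K = 0)"
    if nz: "?c a * ?c b \<noteq> 0" for a b
  proof -
    obtain J where J: "finitely_generated J" "J \<noteq> 0" "ideal_set J \<subseteq> ideal_set (?c a * ?c b)"
      using nonzero_ideal_has_nonzero_finitely_generated_subideal[OF nz] by blast
    obtain z where "?c z = J" using assms(2) J(1) by blast
    then show ?thesis using J(2,3) times_ideal_mono_zero by blast
  qed
  then have "\<exists>p. pre_digraph.awalk (with_proj (zero_divisor_graph ?c UNIV)) x p y \<and> length p \<le> 3"
    if "x \<in> pverts (zero_divisor_graph ?c UNIV)" "y \<in> pverts (zero_divisor_graph ?c UNIV)" for x y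
    using zero_divisor_graph_short_walk[OF _ that] by blast
  then show ?thesis
    using connected_graph_diameter_le_if_short_walks[OF wf_digraph_zero_divisor_graph assms(3), of 3]
    by simp
qed

end
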